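(* For every $n\in\mathbb{N}$, there is a set $X\subseteq\mathbb{R}^2$ of $n$ points with pairwise distinct distance multiplicities (i.e. different distances determined by $X$ have different multiplicities) and $a(X)\neq(n-1,n-2,\ldots,1)$.
   Context: For a finite set $X\subseteq\mathbb{R}^2$ determining $m$ distinct Euclidean distances between its points, the multiplicity of a distance is the number of unordered pairs of distinct points of $X$ at that distance, and $a(X)=(a_1(X),\dots,a_m(X))$ is the list of the multiplicities of all $m$ distances in non-increasing order $a_1(X)\geq\cdots\geq a_m(X)$.
   Formalization: The claim is proved for every n ≥ 3; it fails for smaller n, since any 2 points have a(X) = (1) = (n-1,...,1), and for n ≤ 1 no distance is determined, so a(X) and (n-1,...,1) are both empty. *)

theory Defs
  imports "HOL-Analysis.Analysis" "HOL-Library.Multiset"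
begin

definition distances :: "(real ^ 2) set \<Rightarrow> real set" where
  "distances X = {dist x y |x y. x \<in> X \<and> y \<in> X \<and> x \<noteq> y}"

text \<open>Pairs are unordered, so they are counted as two-element sets.\<close>

definition multiplicity_of_distance :: "(real ^ 2) set \<Rightarrow> real \<Rightarrow> nat" where
  "multiplicity_of_distance X d = card {{x, y} |x y. x \<in> X \<and> y \<in> X \<and> x \<noteq> y \<and> dist x y = d}"

text \<open>
  The list \<open>a(X)\<close> has one entry per distance, so equal multiplicities of different distances
  are repeated; this is why it is built from a multiset. The sort is ascending, hence \<open>rev\<close>.
\<close>

definition multiplicity_list :: "(real ^ 2) set \<Rightarrow> nat list" where
  "multiplicity_list X =
     rev (sorted_list_of_multiset
       (image_mset (multiplicity_of_distance X) (mset_set (distances X))))"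

end

theory Submission
  imports Defs
begin

text \<open>
  Take the centre of the unit circle together with \<open>m + 1 = n - 1\<close> equally spaced points on an
  arc of angle \<open>\<pi>/3\<close>. The chord spanning \<open>k\<close> steps occurs \<open>m + 1 - k\<close> times, and these chords have
  distinct lengths. The longest one, \<open>k = m\<close>, has length \<open>1\<close>, so its multiplicity is
  raised by the \<open>m + 1\<close> radii; hence \<open>a(X) = (n, n - 2, n - 3, \<dots>, 2)\<close>.
\<close>

section \<open>Distances between points of the unit circle\<close>

definition circle_point :: "real \<Rightarrow> real ^ 2" where
  "circle_point t = vector [cos t, sin t]"

lemma dist_circle_point_0: "dist (circle_point t) 0 = 1"
  by (simp add: circle_point_def dist_vec_def L2_set_def sum_2)

lemma dist_circle_point:
  "dist (circle_point a) (circle_point b) = 2 * \<bar>sin ((a - b) / 2)\<bar>"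
proof -
  have "(dist (circle_point a) (circle_point b))\<^sup>2 = (cos a - cos b)\<^sup>2 + (sin a - sin b)\<^sup>2"
    by (simp add: circle_point_def dist_vec_def L2_set_def sum_2 dist_real_def)
  also have "\<dots> = ((cos a)\<^sup>2 + (sin a)\<^sup>2) + ((cos b)\<^sup>2 + (sin b)\<^sup>2) - 2 * cos (a - b)"
    by (simp add: cos_diff power2_eq_square algebra_simps)
  \<comment> \<open>The angle is written as a double so that the half-angle form
    \<open>cos_double_sin\<close> applies next.\<close>
  also have "\<dots> = 2 - 2 * cos (2 * ((a - b) / 2))"
    by (simp del: right_diff_distrib_numeral)
  also have "\<dots> = (2 * \<bar>sin ((a - b) / 2)\<bar>)\<^sup>2"
    unfolding cos_double_sin by (simp add: power_mult_distrib)
  finally show ?thesis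
    by (rule power2_eq_imp_eq) auto
qed

text \<open>A pair of indices at offset \<open>k\<close> is determined by its smaller index, which
  ranges over \<open>0\<close> to \<open>m - k\<close>.\<close>

lemma card_unordered_pairs_shift:
  fixes p :: "nat \<Rightarrow> 'a" and k m :: nat
  assumes "inj_on p {..m}" "0 < k"
  shows "card ((\<lambda>i. {p i, p (i + k)}) ` {i. i + k \<le> m}) = m + 1 - k"
proof -
  have "inj_on (\<lambda>i. {p i, p (i + k)}) {i. i + k \<le> m}"
  proof (rule inj_onI)
    fix i j assume ij: "i \<in> {i. i + k \<le> m}" "j \<in> {i. i + k \<le> m}"
      "{p i, p (i + k)} = {p j, p (j + k)}"
    then consider "p i = p j" | "p i = p (j + k)" "p (i + k) = p j"
      by (auto simp: doubleton_eq_iff)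
    then show "i = j"
    proof cases
      case 1
      then show ?thesis
        using ij by (auto intro: inj_onD[OF assms(1)])
    next
      \<comment> \<open>A crossed match would give \<open>i = i + 2 * k\<close>, impossible for
        positive \<open>k\<close>.\<close>
      case 2
      then have "i = j + k" "i + k = j"
        using ij by (auto intro: inj_onD[OF assms(1)])
      then show ?thesis
        using assms(2) by simp
    qed
  qed
  moreover have "{i. i + k \<le> m} = {..<m + 1 - k}"
    by auto
  ultimately show ?thesis
    by (simp add: card_image)
qed

section \<open>The arc and its chord lengths\<close>

definition arc_point :: "nat \<Rightarrow> nat \<Rightarrow> real ^ 2" where
  "arc_point m i = circle_point (real i * (pi / (3 * real m)))"

text \<open>Length of a chord spanning \<open>k\<close> steps; the half angle in
  \<open>dist_circle_point\<close> turns the \<open>3\<close> of \<open>arc_point\<close> into a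
  \<open>6\<close>.\<close>

definition arc_chord :: "nat \<Rightarrow> nat \<Rightarrow> real" where
  "arc_chord m k = 2 * sin (real k * (pi / (6 * real m)))"

definition arc_with_centre :: "nat \<Rightarrow> (real ^ 2) set" where
  "arc_with_centre m = insert 0 (arc_point m ` {..m})"

lemma arc_chord_0 [simp]: "arc_chord m 0 = 0"
  by (simp add: arc_chord_def)

lemma arc_chord_self:
  assumes "0 < m"
  shows "arc_chord m m = 1"
  using assms by (simp add: arc_chord_def sin_30)

text \<open>The half angles stay within [0, \<pi>/6], where the sine increases. Hence different step
  counts give different distances.\<close>

lemma strict_mono_on_arc_chord:
  assumes "0 < m"
  shows "strict_mono_on {..m} (arc_chord m)"
proof (rule strict_mono_onI)
  fix j k assume jk: "j \<in> {..m}" "k \<in> {..m}" "j < k"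
  have "real k * (pi / (6 * real m)) \<le> real m * (pi / (6 * real m))"
    using jk by (intro mult_right_mono) auto
  also have "\<dots> \<le> pi / 2"
    using assms by simp
  finally have "real k * (pi / (6 * real m)) \<le> pi / 2" .
  moreover have "real j * (pi / (6 * real m)) < real k * (pi / (6 * real m))"
    using jk assms by (intro mult_strict_right_mono) auto
  moreover have "- (pi / 2) \<le> real j * (pi / (6 * real m))"
    by (rule order_trans[of _ 0]) auto
  ultimately show "arc_chord m j < arc_chord m k"
    unfolding arc_chord_def by (simp add: sin_monotone_2pi)
qed

lemma arc_chord_eq_iff:
  assumes "0 < m" "j \<le> m" "k \<le> m"
  shows "arc_chord m j = arc_chord m k \<longleftrightarrow> j = k"
  using strict_mono_on_imp_inj_on[OF strict_mono_on_arc_chord[OF assms(1)]] assms(2,3)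
  by (auto simp: inj_on_def)

lemma dist_arc_point:
  assumes "0 < m" "i + k \<le> m"
  shows "dist (arc_point m i) (arc_point m (i + k)) = arc_chord m k"
proof -
  have "0 \<le> sin (real k * (pi / (6 * real m)))"
    using strict_mono_on_leD[OF strict_mono_on_arc_chord[OF assms(1)], of 0 k] assms
    by (simp add: arc_chord_def)
  moreover have "(real (i + k) * (pi / (3 * real m)) - real i * (pi / (3 * real m))) / 2
      = real k * (pi / (6 * real m))"
    using assms(1) by (simp add: field_simps)
  ultimately show ?thesis
    unfolding arc_point_def arc_chord_def by (subst dist_commute) (simp only: dist_circle_point abs_of_nonneg)
qed

lemma inj_on_arc_point:
  assumes "0 < m"
  shows "inj_on (arc_point m) {..m}"
proof (rule linorder_inj_onI)
  fix i j assume ij: "i < j" "i \<in> {..m}" "j \<in> {..m}"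
  then have "dist (arc_point m i) (arc_point m j) = arc_chord m (j - i)"
    using dist_arc_point[OF assms, of i "j - i"] by simp
  \<comment> \<open>Coinciding points would be at distance \<open>0\<close>, the length of the chord
    of zero steps.\<close>
  moreover have "arc_chord m (j - i) \<noteq> arc_chord m 0"
    using ij assms by (subst arc_chord_eq_iff) auto
  ultimately show "arc_point m i \<noteq> arc_point m j"
    by auto
qed auto

lemma dist_arc_point_0: "dist (arc_point m i) 0 = 1"
  unfolding arc_point_def by (rule dist_circle_point_0)

lemma arc_point_nonzero: "arc_point m i \<noteq> 0"
  using dist_arc_point_0[of m i] by auto

section \<open>Pairs, distances and multiplicities of the arc with its centre\<close>

lemma card_arc_with_centre:
  assumes "0 < m"
  shows "card (arc_with_centre m) = m + 2"
proof -
  have "0 \<notin> arc_point m ` {..m}"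
    by (auto simp: arc_point_nonzero[symmetric])
  then show ?thesis
    by (simp add: arc_with_centre_def card_image[OF inj_on_arc_point[OF assms]])
qed

text \<open>Pairs are either chords or radii. Chords are indexed by start and step count, so that
  \<open>d\<close> will fix \<open>k\<close>; both the distances and their multiplicities are read
  off from this splitting.\<close>

lemma arc_with_centre_pairs:
  assumes "0 < m"
  shows "{{x, y} |x y. x \<in> arc_with_centre m \<and> y \<in> arc_with_centre m \<and> x \<noteq> y \<and> dist x y = d}
    = {{arc_point m i, arc_point m (i + k)} |i k. 0 < k \<and> i + k \<le> m \<and> arc_chord m k = d}
      \<union> {{0, arc_point m i} |i. i \<le> m \<and> d = 1}" (is "?L = ?C \<union> ?R")
proof (intro equalityI subsetI)
  fix A assume "A \<in> ?L"
  then obtain x y where A: "A = {x, y}" and xy: "x \<in> arc_with_centre m" "y \<in> arc_with_centre m"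
    "x \<noteq> y" "dist x y = d"
    by blast
  show "A \<in> ?C \<union> ?R"
  proof (cases "x = 0 \<or> y = 0")
    case True
    then show ?thesis
      using A xy dist_arc_point_0[of m] by (auto simp: arc_with_centre_def dist_commute)
  next
    case False
    have chord: "{arc_point m i, arc_point m j} \<in> ?C"
      if "i < j" "j \<le> m" "dist (arc_point m i) (arc_point m j) = d" for i j
    proof -
      have "arc_chord m (j - i) = d"
        using that dist_arc_point[OF assms, of i "j - i"] by simp
      then show ?thesis
        using that by (intro CollectI exI[of _ i] exI[of _ "j - i"]) auto
    qed
    from False xy obtain i j where ij: "x = arc_point m i" "y = arc_point m j" "i \<le> m" "j \<le> m"
      by (auto simp: arc_with_centre_def)
    with xy(3) have "i < j \<or> j < i"
      by (metis nat_neq_iff)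
    then show ?thesis
      using chord[of i j] chord[of j i] ij xy(4) unfolding A
      by (auto simp only: dist_commute insert_commute)
  qed
next
  fix A assume "A \<in> ?C \<union> ?R"
  then show "A \<in> ?L"
  proof
    assume "A \<in> ?C"
    then obtain i k where ik: "A = {arc_point m i, arc_point m (i + k)}" "0 < k" "i + k \<le> m"
      "arc_chord m k = d"
      by blast
    moreover have "arc_point m i \<noteq> arc_point m (i + k)"
      using inj_onD[OF inj_on_arc_point[OF assms], of i "i + k"] ik by auto
    ultimately show ?thesis
      using dist_arc_point[OF assms, of i k] unfolding arc_with_centre_def
      by (intro CollectI exI[of _ "arc_point m i"] exI[of _ "arc_point m (i + k)"]) auto
  next
    assume "A \<in> ?R"
    then obtain i where "A = {0, arc_point m i}" "i \<le> m" "d = 1"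
      by blast
    then show ?thesis
      using dist_arc_point_0[of m i] arc_point_nonzero[of m i] unfolding arc_with_centre_def
      by (intro CollectI exI[of _ 0] exI[of _ "arc_point m i"]) (auto simp: dist_commute)
  qed
qed

lemma distances_arc_with_centre:
  assumes "0 < m"
  shows "distances (arc_with_centre m) = arc_chord m ` {1..m}"
proof -
  have "d \<in> distances (arc_with_centre m) \<longleftrightarrow> d \<in> arc_chord m ` {1..m}" for d
  proof -
    have "d \<in> distances (arc_with_centre m) \<longleftrightarrow>
      {{x, y} |x y. x \<in> arc_with_centre m \<and> y \<in> arc_with_centre m \<and> x \<noteq> y \<and> dist x y = d} \<noteq> {}"
      unfolding distances_def by blast
    also have "\<dots> \<longleftrightarrow> (\<exists>i k. 0 < k \<and> i + k \<le> m \<and> arc_chord m k = d) \<or> d = 1"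
      unfolding arc_with_centre_pairs[OF assms] by blast
    \<comment> \<open>Start \<open>i = 0\<close> allows every \<open>k\<close> up to
      \<open>m\<close>, and the radius length \<open>1\<close> is already the chord
      \<open>k = m\<close>.\<close>
    also have "\<dots> \<longleftrightarrow> (\<exists>k. 0 < k \<and> k \<le> m \<and> arc_chord m k = d)"
      using arc_chord_self[OF assms] assms by (metis add_0 add_leD2 order_refl)
    also have "\<dots> \<longleftrightarrow> d \<in> arc_chord m ` {1..m}"
      by (auto simp: Suc_le_eq)
    finally show ?thesis .
  qed
  then show ?thesis
    by blast
qed

lemma multiplicity_arc_chord:
  assumes "0 < k" "k \<le> m"
  shows "multiplicity_of_distance (arc_with_centre m) (arc_chord m k)
    = (if k = m then m + 2 else m + 1 - k)"
proof -
  have m: "0 < m"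
    using assms by simp
  let ?C = "(\<lambda>i. {arc_point m i, arc_point m (i + k)}) ` {i. i + k \<le> m}"
  \<comment> \<open>The radii count only towards the longest chord; for \<open>k < m\<close> this
    set is empty.\<close>
  let ?R = "(\<lambda>i. {0, arc_point m i}) ` {i. i \<le> m \<and> k = m}"
  have one: "arc_chord m k = 1 \<longleftrightarrow> k = m"
    using arc_chord_eq_iff[OF m, of k m] arc_chord_self[OF m] assms by simp
  \<comment> \<open>Injectivity of \<open>arc_chord m\<close> forces \<open>l = k\<close>.\<close>
  have "{{arc_point m i, arc_point m (i + l)} |i l. 0 < l \<and> i + l \<le> m \<and> arc_chord m l = arc_chord m k}
      = ?C"
    using arc_chord_eq_iff[OF m _ assms(2)] assms(1) by fastforce
  moreover have "{{0, arc_point m i} |i. i \<le> m \<and> arc_chord m k = 1} = ?R"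
    unfolding one by blast
  ultimately have "multiplicity_of_distance (arc_with_centre m) (arc_chord m k) = card (?C \<union> ?R)"
    unfolding multiplicity_of_distance_def arc_with_centre_pairs[OF m] by simp
  also have "\<dots> = card ?C + card ?R"
  proof (rule card_Un_disjoint)
    show "finite ?C"
      by (rule finite_imageI, rule finite_subset[of _ "{..m}"]) auto
    show "?C \<inter> ?R = {}"
      using arc_point_nonzero[of m] by (auto simp: doubleton_eq_iff)
  qed simp
  also have "card ?C = m + 1 - k"
    by (rule card_unordered_pairs_shift[OF inj_on_arc_point[OF m] assms(1)])
  also have "card ?R = (if k = m then m + 1 else 0)"
  proof -
    have "inj_on (\<lambda>i. {0, arc_point m i}) {..m}"
      using inj_on_arc_point[OF m] by (auto simp: inj_on_def doubleton_eq_iff)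
    from card_image[OF this] show ?thesis
      by (simp add: atMost_def)
  qed
  finally show ?thesis
    by auto
qed

lemma set_multiplicity_list:
  assumes "finite (distances X)"
  shows "set (multiplicity_list X) = multiplicity_of_distance X ` distances X"
  using assms by (simp add: multiplicity_list_def)

text \<open>For \<open>n\<close> at most \<open>2\<close> the claim fails: the only possible list is
  then \<open>[]\<close> or \<open>[1]\<close>, which is \<open>rev [1..<n]\<close>.\<close>

theorem proposition5p3:
  fixes n :: nat
  assumes "n \<ge> 3"
  shows "\<exists>X :: (real ^ 2) set. finite X \<and> card X = n \<and>
           inj_on (multiplicity_of_distance X) (distances X) \<and>
           multiplicity_list X \<noteq> rev [1..<n]"
proof -
  \<comment> \<open>The arc is cut into \<open>m\<close> steps, giving \<open>m + 1\<close> points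
    besides the centre.\<close>
  define m where "m = n - 2"
  have m: "0 < m" and n: "n = m + 2"
    using assms by (auto simp: m_def)
  let ?X = "arc_with_centre m"
  have "inj_on (multiplicity_of_distance ?X) (distances ?X)"
    unfolding distances_arc_with_centre[OF m]
  proof (intro inj_onI, elim imageE, hypsubst)
    fix j k assume "j \<in> {1..m}" "k \<in> {1..m}"
      "multiplicity_of_distance ?X (arc_chord m j) = multiplicity_of_distance ?X (arc_chord m k)"
    \<comment> \<open>Below \<open>m\<close> the multiplicities \<open>m + 1 - k\<close> are
      distinct and at most \<open>m\<close>, while \<open>k = m\<close> gives
      \<open>m + 2\<close>.\<close>
    then have "j = k"
      by (auto simp: multiplicity_arc_chord Suc_le_eq split: if_splits)
    then show "arc_chord m j = arc_chord m k"
      by simp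
  qed
  \<comment> \<open>The entry \<open>n\<close> separates the lists, since all entries of
    \<open>rev [1..<n]\<close> are smaller.\<close>
  moreover have "n \<in> set (multiplicity_list ?X)"
  proof -
    have "multiplicity_of_distance ?X (arc_chord m m) = n"
      using m n by (simp add: multiplicity_arc_chord)
    then have "n \<in> multiplicity_of_distance ?X ` distances ?X"
      unfolding distances_arc_with_centre[OF m] using m by force
    then show ?thesis
      by (simp add: set_multiplicity_list distances_arc_with_centre[OF m])
  qed
  then have "multiplicity_list ?X \<noteq> rev [1..<n]"
    by auto
  moreover have "finite ?X" "card ?X = n"
    using card_arc_with_centre[OF m] n by (auto simp: arc_with_centre_def)
  ultimately show ?thesis
    by blast
qed

end
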